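(* Let $d\ge2$ and let $$|\psi\rangle_{12}=\sum_{k=0}^{d-1}\sqrt{\lambda_k}\,|kk\rangle_{12},\qquad |\chi\rangle_{34}=\sum_{k=0}^{d-1}\sqrt{\eta_k}\,|kk\rangle_{34}$$ be normalized pure states in Schmidt form ($\lambda_k,\eta_k\ge0$, $\sum_k\lambda_k=\sum_k\eta_k=1$), where $\{|k\rangle_i\}_{k=0}^{d-1}$ is an orthonormal basis of the $d$-dimensional Hilbert space of system $i\in\{1,2,3,4\}$. Let $\theta_{mm'}\in\mathbb{R}$ ($m,m'=0,\dots,d-1$) be arbitrary. For $j,j'\in\{0,\dots,d-1\}$ set $$|P^{(j,j')}\rangle_{23}=\frac1d\sum_{m,m'=0}^{d-1}e^{i\left[\frac{2\pi}{d^2}(dj+j')(dm+m')+\theta_{mm'}\right]}|mm'\rangle_{23},$$ and define unitaries on systems $4$ and $1$ by $$\hat U_b^{(j,j')}|m'\rangle_4=e^{i\frac{2\pi}{d^2}(dj+j')m'}|m'\rangle_4,\qquad \hat U_a^{(j')}|m\rangle_1=e^{i\frac{2\pi}{d}j'm}|m\rangle_1.$$ Then the $d^2$ vectors $|P^{(j,j')}\rangle_{23}$ are orthonormal. Moreover, if Sapna (holding systems $2,3$) performs on $|\psi\rangle_{12}\otimes|\chi\rangle_{34}$ the projective measurement $\{|P^{(j,j')}\rangle_{23}\langle P^{(j,j')}|\}_{j,j'}$, and upon outcome $(j,j')$ Alice applies $\hat U_a^{(j')}$ to system $1$ and Bob applies $\hat U_b^{(j,j')}$ to system $4$, then for every outcome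 $(j,j')$ the final state shared by Alice and Bob is $$|F\rangle_{14}=\sum_{m=0}^{d-1}\sum_{m'=0}^{d-1}e^{-i\theta_{mm'}}\sqrt{\lambda_m\eta_{m'}}\,|mm'\rangle_{14},$$ independent of $(j,j')$.
   Context: Alice holds system $1$, Bob holds system $4$, Sapna holds systems $2$ and $3$. Notation: $|mm'\rangle_{ab}=|m\rangle_a\otimes|m'\rangle_b$. After Sapna's measurement with outcome $(j,j')$, the post-measurement state is $|P^{(j,j')}\rangle_{23}$ tensored with a pure state of systems $1,4$, which is the normalization of the partial inner product of $|P^{(j,j')}\rangle_{23}$ with $|\psi\rangle_{12}\otimes|\chi\rangle_{34}$. Pure states are understood up to global phase. *)

theory Defs
  imports "HOL-Analysis.Analysis"
begin

text \<open>A system with a \<open>d\<close>-dimensional Hilbert space is modelled by \<open>complex ^ 'a\<close> with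
  \<open>CARD('a) = d\<close>; a composite system is indexed by the product type. The library norm on
  \<open>complex ^ 'a\<close> is the Hilbert space norm, so \<open>sgn v\<close> is the normalization \<open>v / \<parallel>v\<parallel>\<close>.\<close>

definition cinner :: "complex ^ 'a \<Rightarrow> complex ^ 'a \<Rightarrow> complex" where
  "cinner u v = (\<Sum>i\<in>UNIV. cnj (u $ i) * v $ i)"

definition orthonormal_on :: "'i set \<Rightarrow> ('i \<Rightarrow> complex ^ 'a) \<Rightarrow> bool" where
  "orthonormal_on I f \<longleftrightarrow> (\<forall>i\<in>I. \<forall>k\<in>I. cinner (f i) (f k) = (if i = k then 1 else 0))"

definition hermitian_adjoint :: "complex ^ 'a ^ 'b \<Rightarrow> complex ^ 'b ^ 'a" where
  "hermitian_adjoint A = (\<chi> i k. cnj (A $ k $ i))"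

definition unitary_matrix :: "complex ^ 'a ^ 'a \<Rightarrow> bool" where
  "unitary_matrix U \<longleftrightarrow>
     hermitian_adjoint U ** U = mat 1 \<and> U ** hermitian_adjoint U = mat 1"

definition same_state :: "complex ^ 'a \<Rightarrow> complex ^ 'a \<Rightarrow> bool" where
  "same_state u v \<longleftrightarrow> (\<exists>c. cmod c = 1 \<and> u = c *s v)"

definition tensor :: "complex ^ 'a \<Rightarrow> complex ^ 'b \<Rightarrow> complex ^ ('a::finite \<times> 'b::finite)" where
  "tensor u v = (\<chi> p. u $ fst p * v $ snd p)"

definition tensor_matrix ::
    "complex ^ 'a ^ 'a \<Rightarrow> complex ^ 'b ^ 'b \<Rightarrow> complex ^ ('a::finite \<times> 'b::finite) ^ ('a \<times> 'b)" where
  "tensor_matrix A B = (\<chi> p q. A $ fst p $ fst q * B $ snd p $ snd q)"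

definition ket_bra :: "complex ^ 'a \<Rightarrow> complex ^ 'a ^ 'a" where
  "ket_bra v = (\<chi> i k. v $ i * cnj (v $ k))"

definition projective_measurement :: "'i set \<Rightarrow> ('i \<Rightarrow> complex ^ 'a ^ 'a) \<Rightarrow> bool" where
  "projective_measurement I Q \<longleftrightarrow>
     (\<forall>i\<in>I. hermitian_adjoint (Q i) = Q i) \<and>
     (\<forall>i\<in>I. \<forall>k\<in>I. Q i ** Q k = (if i = k then Q i else 0)) \<and>
     (\<Sum>i\<in>I. Q i) = mat 1"

text \<open>The four systems 1, 2, 3, 4 are indexed as \<open>((a, b), (c, d))\<close>, the format of a product
  of a state of 12 with a state of 34. The following three definitions place a pair of states
  of 14 and 23 into this format, extend an operator on 23 by the identity on 1 and 4, and take
  the partial inner product over 23 (conjugate-linear in the first argument).\<close>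

definition tensor_14_23 ::
    "complex ^ ('a::finite \<times> 'd::finite) \<Rightarrow> complex ^ ('b::finite \<times> 'c::finite) \<Rightarrow> complex ^ (('a \<times> 'b) \<times> ('c \<times> 'd))" where
  "tensor_14_23 u v = (\<chi> p. case p of ((a, b), (c, d)) \<Rightarrow> u $ (a, d) * v $ (b, c))"

definition extend_23 ::
    "complex ^ ('b::finite \<times> 'c::finite) ^ ('b \<times> 'c) \<Rightarrow>
     complex ^ (('a::finite \<times> 'b) \<times> ('c \<times> 'd::finite)) ^ (('a \<times> 'b) \<times> ('c \<times> 'd))" where
  "extend_23 A = (\<chi> p q. case (p, q) of (((a, b), (c, d)), ((a', b'), (c', d'))) \<Rightarrow>
     if a = a' \<and> d = d' then A $ (b, c) $ (b', c') else 0)"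

definition partial_inner_23 ::
    "complex ^ ('b::finite \<times> 'c::finite) \<Rightarrow> complex ^ (('a::finite \<times> 'b) \<times> ('c \<times> 'd::finite)) \<Rightarrow> complex ^ ('a \<times> 'd)" where
  "partial_inner_23 v w =
     (\<chi> p. case p of (a, d) \<Rightarrow>
        (\<Sum>b\<in>UNIV. \<Sum>c\<in>UNIV. cnj (v $ (b, c)) * w $ ((a, b), (c, d))))"

definition schmidt_state ::
    "nat \<Rightarrow> (nat \<Rightarrow> real) \<Rightarrow> (nat \<Rightarrow> complex ^ 'a::finite) \<Rightarrow> (nat \<Rightarrow> complex ^ 'b::finite) \<Rightarrow> complex ^ ('a \<times> 'b)" where
  "schmidt_state d \<mu> e f = (\<Sum>k<d. complex_of_real (sqrt (\<mu> k)) *s tensor (e k) (f k))"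

definition P_state ::
    "nat \<Rightarrow> (nat \<Rightarrow> nat \<Rightarrow> real) \<Rightarrow> (nat \<Rightarrow> complex ^ 'b::finite) \<Rightarrow> (nat \<Rightarrow> complex ^ 'c::finite) \<Rightarrow>
     nat \<Rightarrow> nat \<Rightarrow> complex ^ ('b \<times> 'c)" where
  "P_state d \<theta> e f j j' = complex_of_real (1 / real d) *s
     (\<Sum>m<d. \<Sum>m'<d.
        exp (\<i> * complex_of_real (2 * pi / real d ^ 2 * real (d * j + j') * real (d * m + m') + \<theta> m m'))
          *s tensor (e m) (f m'))"

definition F_state ::
    "nat \<Rightarrow> (nat \<Rightarrow> nat \<Rightarrow> real) \<Rightarrow> (nat \<Rightarrow> real) \<Rightarrow> (nat \<Rightarrow> real) \<Rightarrow>
     (nat \<Rightarrow> complex ^ 'a::finite) \<Rightarrow> (nat \<Rightarrow> complex ^ 'd::finite) \<Rightarrow> complex ^ ('a \<times> 'd)" where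
  "F_state d \<theta> \<mu> \<eta> e f =
     (\<Sum>m<d. \<Sum>m'<d.
        (exp (- \<i> * complex_of_real (\<theta> m m')) * complex_of_real (sqrt (\<mu> m * \<eta> m')))
          *s tensor (e m) (f m'))"

end

theory Submission
  imports Defs
begin

text \<open>Writing \<open>J = d j + j'\<close> and \<open>M = d m + m'\<close>, the measurement vectors are, up to the phases
  \<open>\<theta>\<close>, the discrete Fourier basis of dimension \<open>d\<^sup>2\<close>. The partial inner product with outcome \<open>J\<close>
  multiplies the amplitude of \<open>mm'\<close> by \<open>exp (- 2 \<pi> \<i> J M / d\<^sup>2) / d\<close>, and
  \<open>J M / d\<^sup>2 = j m + j' m / d + J m' / d\<^sup>2\<close>: the first term is an integer and the other two are the
  phases undone by Alice and by Bob.\<close>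

section \<open>Inner products and expansions in orthonormal families\<close>

lemma cinner_sum_right: "cinner u (\<Sum>i\<in>I. f i) = (\<Sum>i\<in>I. cinner u (f i))"
  unfolding cinner_def sum_component sum_distrib_left by (rule sum.swap)

lemma cinner_sum_left: "cinner (\<Sum>i\<in>I. f i) u = (\<Sum>i\<in>I. cinner (f i) u)"
  unfolding cinner_def sum_component cnj_sum sum_distrib_right by (rule sum.swap)

lemma cinner_smult_right: "cinner u (c *s v) = c * cinner u v"
  by (simp add: cinner_def sum_distrib_left mult_ac)

lemma cinner_smult_left: "cinner (c *s u) v = cnj c * cinner u v"
  by (simp add: cinner_def sum_distrib_left mult_ac)

lemma cinner_self: "cinner v v = of_real ((norm v)\<^sup>2)"
proof -
  have "(norm v)\<^sup>2 = (\<Sum>i\<in>UNIV. (cmod (v $ i))\<^sup>2)"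
    by (simp add: norm_vec_def L2_set_def sum_nonneg)
  then show ?thesis
    by (simp add: cinner_def complex_norm_square mult.commute del: of_real_power)
qed

text \<open>Parseval's identity: orthonormality collapses the double sum to its diagonal. The
  overlaps of the measurement vectors, the partial inner product and the norm of the resulting state
  of 14 are all computed this way.\<close>

lemma cinner_orthonormal_expansion:
  assumes "orthonormal_on I f" "finite I"
  shows "cinner (\<Sum>i\<in>I. a i *s f i) (\<Sum>i\<in>I. b i *s f i) = (\<Sum>i\<in>I. cnj (a i) * b i)"
proof -
  have "cinner (\<Sum>i\<in>I. a i *s f i) (\<Sum>i\<in>I. b i *s f i)
      = (\<Sum>i\<in>I. \<Sum>k\<in>I. cnj (a i) * b k * cinner (f i) (f k))"
    unfolding cinner_sum_left unfolding cinner_sum_right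
    by (simp add: cinner_smult_left cinner_smult_right mult_ac)
  also have "\<dots> = (\<Sum>i\<in>I. \<Sum>k\<in>I. if i = k then cnj (a i) * b k else 0)"
    using assms(1) by (intro sum.cong refl) (auto simp: orthonormal_on_def)
  also have "\<dots> = (\<Sum>i\<in>I. cnj (a i) * b i)"
    using assms(2) by simp
  finally show ?thesis .
qed

lemma cinner_tensor: "cinner (tensor u v) (tensor u' v') = cinner u u' * cinner v v'"
  by (simp add: cinner_def tensor_def sum_product sum.cartesian_product UNIV_Times_UNIV[symmetric]
      case_prod_beta mult_ac del: UNIV_Times_UNIV)

lemma orthonormal_on_tensor:
  assumes "orthonormal_on I e" "orthonormal_on J f"
  shows "orthonormal_on (I \<times> J) (\<lambda>q. tensor (e (fst q)) (f (snd q)))"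
  using assms by (auto simp: orthonormal_on_def cinner_tensor)

section \<open>Completeness of orthonormal bases and the spectral form of operators\<close>

lemma sum_ket_bra_orthonormal:
  fixes f :: "'i \<Rightarrow> complex ^ 'a::finite"
  assumes on: "orthonormal_on I f" and fin: "finite I" and card: "card I = CARD('a)"
  shows "(\<Sum>i\<in>I. ket_bra (f i)) = mat 1"
proof -
  obtain g where g: "bij_betw g (UNIV :: 'a set) I"
    using finite_same_card_bij[of "UNIV :: 'a set" I] fin card by auto
  \<comment> \<open>The basis vectors are the columns of \<open>E\<close>, so orthonormality says
    that the adjoint of \<open>E\<close> is a left inverse. For a square matrix it is then also a
    right inverse, and that product is the completeness sum.\<close>
  define E :: "complex ^ 'a ^ 'a" where "E = (\<chi> a b. f (g b) $ a)"
  have "hermitian_adjoint E ** E = mat 1"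
  proof (intro vec_eq_iff[THEN iffD2] allI)
    fix a b
    have "g a \<in> I" "g b \<in> I" "g a = g b \<longleftrightarrow> a = b"
      using g by (auto simp: bij_betw_def inj_on_def)
    moreover have "(hermitian_adjoint E ** E) $ a $ b = cinner (f (g a)) (f (g b))"
      by (simp add: matrix_matrix_mult_def hermitian_adjoint_def E_def cinner_def)
    ultimately show "(hermitian_adjoint E ** E) $ a $ b = mat 1 $ a $ b"
      using on by (simp add: orthonormal_on_def mat_def)
  qed
  then have "E ** hermitian_adjoint E = mat 1"
    by (simp add: matrix_left_right_inverse)
  moreover have "E ** hermitian_adjoint E = (\<Sum>i\<in>I. ket_bra (f i))"
  proof (intro vec_eq_iff[THEN iffD2] allI)
    fix a b
    have "(E ** hermitian_adjoint E) $ a $ b = (\<Sum>x\<in>UNIV. ket_bra (f (g x)) $ a $ b)"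
      by (simp add: matrix_matrix_mult_def hermitian_adjoint_def E_def ket_bra_def)
    also have "\<dots> = (\<Sum>i\<in>I. ket_bra (f i) $ a $ b)"
      by (rule sum.reindex_bij_betw[OF g])
    finally show "(E ** hermitian_adjoint E) $ a $ b = (\<Sum>i\<in>I. ket_bra (f i)) $ a $ b"
      by simp
  qed
  ultimately show ?thesis by simp
qed

lemma ket_bra_mult_ket_bra:
  "(ket_bra u ** ket_bra v) $ a $ b = cinner u v * (u $ a * cnj (v $ b))"
  by (simp add: matrix_matrix_mult_def ket_bra_def cinner_def sum_distrib_left sum_distrib_right mult_ac)

lemma projective_measurement_ket_bra:
  fixes f :: "'i \<Rightarrow> complex ^ 'a::finite"
  assumes on: "orthonormal_on I f" and "finite I" "card I = CARD('a)"
  shows "projective_measurement I (\<lambda>i. ket_bra (f i))"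
proof -
  have "ket_bra (f i) ** ket_bra (f k) = (if i = k then ket_bra (f i) else 0)"
    if "i \<in> I" "k \<in> I" for i k
    using on that by (simp add: vec_eq_iff ket_bra_mult_ket_bra orthonormal_on_def)
      (simp add: ket_bra_def)
  moreover have "hermitian_adjoint (ket_bra v) = ket_bra v" for v :: "complex ^ 'a"
    by (simp add: hermitian_adjoint_def ket_bra_def vec_eq_iff mult.commute)
  ultimately show ?thesis
    using sum_ket_bra_orthonormal[OF assms] by (simp add: projective_measurement_def)
qed

text \<open>Inserting the completeness relation to the right of \<open>U\<close> turns its action on
  the basis into its spectral sum. Since the basis may differ from the standard one, this is how the
  entries, and hence the adjoint, become accessible.\<close>

lemma matrix_diagonal_in_orthonormal_basis:
  fixes f :: "'i \<Rightarrow> complex ^ 'a::finite" and U :: "complex ^ 'a ^ 'a"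
  assumes "orthonormal_on I f" "finite I" "card I = CARD('a)"
    and eig: "\<And>i. i \<in> I \<Longrightarrow> U *v f i = c i *s f i"
  shows "U $ a $ b = (\<Sum>i\<in>I. c i * f i $ a * cnj (f i $ b))"
proof -
  have "U $ a $ b = (U ** (\<Sum>i\<in>I. ket_bra (f i))) $ a $ b"
    by (simp add: sum_ket_bra_orthonormal[OF assms(1-3)])
  also have "\<dots> = (\<Sum>x\<in>UNIV. \<Sum>i\<in>I. U $ a $ x * (f i $ x * cnj (f i $ b)))"
    by (simp add: matrix_matrix_mult_def ket_bra_def sum_distrib_left)
  also have "\<dots> = (\<Sum>i\<in>I. \<Sum>x\<in>UNIV. U $ a $ x * (f i $ x * cnj (f i $ b)))"
    by (rule sum.swap)
  also have "\<dots> = (\<Sum>i\<in>I. (U *v f i) $ a * cnj (f i $ b))"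
    by (simp add: matrix_vector_mult_def sum_distrib_left sum_distrib_right mult_ac)
  also have "\<dots> = (\<Sum>i\<in>I. c i * f i $ a * cnj (f i $ b))"
    by (intro sum.cong refl) (simp add: eig)
  finally show ?thesis .
qed

lemma matrix_vector_mult_ket_bra_sum:
  "(\<Sum>x\<in>UNIV. (\<Sum>i\<in>I. c i * f i $ a * cnj (f i $ x)) * v $ x)
    = (\<Sum>i\<in>I. c i * cinner (f i) v * f i $ a)"
proof -
  have "(\<Sum>x\<in>UNIV. (\<Sum>i\<in>I. c i * f i $ a * cnj (f i $ x)) * v $ x)
      = (\<Sum>x\<in>UNIV. \<Sum>i\<in>I. c i * f i $ a * (cnj (f i $ x) * v $ x))"
    by (simp add: sum_distrib_left sum_distrib_right mult_ac)
  also have "\<dots> = (\<Sum>i\<in>I. \<Sum>x\<in>UNIV. c i * f i $ a * (cnj (f i $ x) * v $ x))"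
    by (rule sum.swap)
  finally show ?thesis
    by (simp add: cinner_def sum_distrib_left mult_ac)
qed

text \<open>By the spectral sum, the adjoint has the same eigenvectors with conjugate eigenvalues.
  So the adjoint times \<open>U\<close> has eigenvalue 1 on the whole basis and shares its spectral
  sum with the identity. Both local corrections are unitary for this reason.\<close>

lemma unitary_matrix_diagonal:
  fixes f :: "'i \<Rightarrow> complex ^ 'a::finite" and U :: "complex ^ 'a ^ 'a"
  assumes on: "orthonormal_on I f" and fin: "finite I" and card: "card I = CARD('a)"
    and eig: "\<And>i. i \<in> I \<Longrightarrow> U *v f i = c i *s f i"
    and unit: "\<And>i. i \<in> I \<Longrightarrow> cmod (c i) = 1"
  shows "unitary_matrix U"
proof -
  note U = matrix_diagonal_in_orthonormal_basis[OF on fin card eig]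
  have adj: "hermitian_adjoint U *v f k = cnj (c k) *s f k" if k: "k \<in> I" for k
  proof (intro vec_eq_iff[THEN iffD2] allI)
    fix a
    have "(hermitian_adjoint U *v f k) $ a
        = (\<Sum>x\<in>UNIV. (\<Sum>i\<in>I. cnj (c i) * f i $ a * cnj (f i $ x)) * f k $ x)"
      by (simp add: matrix_vector_mult_def hermitian_adjoint_def U mult_ac)
    also have "\<dots> = (\<Sum>i\<in>I. cnj (c i) * cinner (f i) (f k) * f i $ a)"
      by (rule matrix_vector_mult_ket_bra_sum)
    also have "\<dots> = (\<Sum>i\<in>I. if i = k then cnj (c i) * f i $ a else 0)"
      using on k by (intro sum.cong refl) (auto simp: orthonormal_on_def)
    also have "\<dots> = (cnj (c k) *s f k) $ a"
      using fin k by simp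
    finally show "(hermitian_adjoint U *v f k) $ a = (cnj (c k) *s f k) $ a" .
  qed
  have "(hermitian_adjoint U ** U) *v f k = 1 *s f k" if "k \<in> I" for k
    using unit[OF that] complex_norm_square[of "c k"] that
    by (simp add: matrix_vector_mul_assoc[symmetric] eig adj matrix_vector_mult_scaleR
        vector_scalar_commute)
  then have "(hermitian_adjoint U ** U) $ a $ b = (\<Sum>i\<in>I. 1 * f i $ a * cnj (f i $ b))" for a b
    by (intro matrix_diagonal_in_orthonormal_basis[OF on fin card]) auto
  moreover have "mat 1 $ a $ b = (\<Sum>i\<in>I. 1 * f i $ a * cnj (f i $ b))" for a b :: 'a
    by (intro matrix_diagonal_in_orthonormal_basis[OF on fin card]) auto
  ultimately have left: "hermitian_adjoint U ** U = mat 1"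
    by (simp add: vec_eq_iff)
  then show ?thesis
    by (simp add: unitary_matrix_def matrix_left_right_inverse)
qed

section \<open>The rank-one measurement on systems 2 and 3\<close>

lemma sum_UNIV_prod:
  fixes h :: "'a::finite \<times> 'b::finite \<Rightarrow> 'c::comm_monoid_add"
  shows "(\<Sum>p\<in>UNIV. h p) = (\<Sum>a\<in>UNIV. \<Sum>b\<in>UNIV. h (a, b))"
  by (simp add: sum.cartesian_product)

text \<open>The projector always leaves \<open>v\<close> on 23; its coefficient, as a function of
  the indices of 1 and 4, is the partial inner product. So the state after the measurement is a
  product across the split 14 against 23.\<close>

lemma extend_23_ket_bra_mult:
  fixes w :: "complex ^ (('a::finite \<times> 'b::finite) \<times> ('c::finite \<times> 'd::finite))"
  shows "extend_23 (ket_bra v) *v w = tensor_14_23 (partial_inner_23 v w) v"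
proof (intro vec_eq_iff[THEN iffD2] allI)
  fix p :: "('a \<times> 'b) \<times> ('c \<times> 'd)"
  obtain a b c d where p: "p = ((a, b), (c, d))"
    by (metis prod.exhaust)
  have "(extend_23 (ket_bra v) *v w) $ p
     = (\<Sum>a'\<in>UNIV. \<Sum>b'\<in>UNIV. \<Sum>c'\<in>UNIV. \<Sum>d'\<in>UNIV. 
         (if a = a' \<and> d = d' then v $ (b, c) * cnj (v $ (b', c')) else 0) * w $ ((a', b'), (c', d')))"
    by (simp add: matrix_vector_mult_def extend_23_def p ket_bra_def sum_UNIV_prod
        cong: if_cong)
  also have "\<dots> = (\<Sum>a'\<in>UNIV. if a = a' then \<Sum>b'\<in>UNIV. \<Sum>c'\<in>UNIV. \<Sum>d'\<in>UNIV. 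
         (if d = d' then v $ (b, c) * cnj (v $ (b', c')) * w $ ((a', b'), (c', d')) else 0) else 0)"
    by (intro sum.cong refl) (simp add: mult_delta_left)
  also have "\<dots> = (\<Sum>b'\<in>UNIV. \<Sum>c'\<in>UNIV. 
         v $ (b, c) * cnj (v $ (b', c')) * w $ ((a, b'), (c', d)))"
    by simp
  also have "\<dots> = tensor_14_23 (partial_inner_23 v w) v $ p"
    by (simp add: tensor_14_23_def partial_inner_23_def p sum_distrib_left sum_distrib_right mult_ac)
  finally show "(extend_23 (ket_bra v) *v w) $ p = tensor_14_23 (partial_inner_23 v w) v $ p" .
qed

lemma cinner_tensor_14_23:
  "cinner (tensor_14_23 u v) (tensor_14_23 u' v') = cinner u u' * cinner v v'"
proof -
  \<comment> \<open>Regrouping from the split 14 against 23, where the double sum factors, to the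
    index format 12 against 34.\<close>
  have bij: "bij_betw (\<lambda>((a, d), (b, c)). ((a, b), (c, d)))
      (UNIV :: (('a \<times> 'd) \<times> ('b \<times> 'c)) set) (UNIV :: (('a \<times> 'b) \<times> ('c \<times> 'd)) set)"
    by (rule bij_betwI[where g = "\<lambda>((a, b), (c, d)). ((a, d), (b, c))"]) auto
  have "cinner u u' * cinner v v'
      = (\<Sum>p\<in>UNIV. cnj (u $ fst p) * u' $ fst p * (cnj (v $ snd p) * v' $ snd p))"
    by (simp add: cinner_def sum_product sum.cartesian_product case_prod_beta)
  also have "\<dots> = (\<Sum>p\<in>UNIV. cnj (tensor_14_23 u v $ p) * tensor_14_23 u' v' $ p)"
    by (subst sum.reindex_bij_betw[OF bij, symmetric])
      (auto intro!: sum.cong simp: tensor_14_23_def)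
  finally show ?thesis by (simp add: cinner_def)
qed

lemma norm_tensor_14_23: "norm (tensor_14_23 u v) = norm u * norm v"
proof -
  have "complex_of_real ((norm (tensor_14_23 u v))\<^sup>2) = of_real ((norm u * norm v)\<^sup>2)"
    using cinner_tensor_14_23[of u v u v] by (simp add: cinner_self power_mult_distrib)
  then show ?thesis
    by (simp only: of_real_eq_iff) (simp add: power2_eq_iff_nonneg)
qed

text \<open>Norms multiply across the split 14 against 23, so with a unit vector on 23 the
  normalization acts on the factor of 14 alone.\<close>

lemma sgn_tensor_14_23:
  assumes "norm v = 1"
  shows "sgn (tensor_14_23 u v) = tensor_14_23 (sgn u) v"
  unfolding sgn_vec_def norm_tensor_14_23 assms by (auto simp: vec_eq_iff tensor_14_23_def)

lemma tensor_matrix_mult_tensor: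
  "tensor_matrix A B *v tensor u v = tensor (A *v u) (B *v v)"
  by (simp add: vec_eq_iff tensor_matrix_def tensor_def matrix_vector_mult_def sum_product
      sum.cartesian_product UNIV_Times_UNIV[symmetric] case_prod_beta mult_ac del: UNIV_Times_UNIV)

lemma tensor_smult: "tensor (a *s u) (b *s v) = (a * b) *s tensor u v"
  by (simp add: vec_eq_iff tensor_def mult_ac)

lemma matrix_vector_mult_sum_smult:
  fixes A :: "complex ^ 'n ^ 'm"
  shows "A *v (\<Sum>i\<in>I. c i *s f i) = (\<Sum>i\<in>I. c i *s (A *v f i))"
  by (simp add: linear_sum[OF matrix_vector_mul_linear, unfolded o_def] vector_scalar_commute)

text \<open>The mechanism of entanglement swapping: \<open>f i\<close> occurs only next to
  \<open>e i\<close>, and \<open>g j\<close> only next to \<open>h j\<close>, so contracting 23 with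
  a vector expanded in products of \<open>f\<close> and \<open>g\<close> moves its conjugated
  coefficients onto the products of \<open>e\<close> and \<open>h\<close>.\<close>

lemma partial_inner_23_schmidt:
  fixes f :: "'i \<Rightarrow> complex ^ 'b::finite" and g :: "'j \<Rightarrow> complex ^ 'c::finite"
    and e :: "'i \<Rightarrow> complex ^ 'a::finite" and h :: "'j \<Rightarrow> complex ^ 'd::finite"
  assumes f: "orthonormal_on I f" "finite I" and g: "orthonormal_on J g" "finite J"
  shows "partial_inner_23 (\<Sum>q\<in>I \<times> J. p q *s tensor (f (fst q)) (g (snd q)))
      (tensor (\<Sum>i\<in>I. s i *s tensor (e i) (f i)) (\<Sum>j\<in>J. t j *s tensor (g j) (h j)))
    = (\<Sum>q\<in>I \<times> J. (cnj (p q) * (s (fst q) * t (snd q))) *s tensor (e (fst q)) (h (snd q)))"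
    (is "partial_inner_23 ?v ?w = ?r")
proof (intro vec_eq_iff[THEN iffD2] allI)
  fix x :: "'a \<times> 'd"
  obtain a d where x: "x = (a, d)" by (cases x)
  define T where "T = (\<lambda>q. tensor (f (fst q)) (g (snd q)))"
  have on: "orthonormal_on (I \<times> J) T"
    using orthonormal_on_tensor[OF f(1) g(1)] by (simp add: T_def)
  \<comment> \<open>For fixed \<open>a\<close> and \<open>d\<close> the entries of \<open>?w\<close> form a vector of 23 that is expanded in \<open>T\<close>.\<close>
  define z where "z = (\<lambda>q. s (fst q) * e (fst q) $ a * (t (snd q) * h (snd q) $ d))"
  have w: "?w $ ((a, b), (c, d)) = (\<Sum>q\<in>I \<times> J. z q *s T q) $ (b, c)" for b c
    by (simp add: tensor_def sum_product sum.cartesian_product case_prod_beta z_def T_def mult_ac)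
  have "partial_inner_23 ?v ?w $ x = cinner (\<Sum>q\<in>I \<times> J. p q *s T q) (\<Sum>q\<in>I \<times> J. z q *s T q)"
    unfolding x partial_inner_23_def
    by (simp add: w cinner_def sum.cartesian_product case_prod_beta del: sum_component)
      (simp add: T_def)
  also have "\<dots> = (\<Sum>q\<in>I \<times> J. cnj (p q) * z q)"
    by (rule cinner_orthonormal_expansion[OF on]) (simp add: f g)
  also have "\<dots> = ?r $ x"
    by (simp add: x z_def tensor_def mult_ac)
  finally show "partial_inner_23 ?v ?w $ x = ?r $ x" .
qed

section \<open>Orthogonality of the discrete Fourier characters\<close>

lemma sum_nat_lex:
  fixes d :: nat and f :: "nat \<Rightarrow> 'a::comm_monoid_add"
  shows "(\<Sum>m<d. \<Sum>m'<k. f (k * m + m')) = (\<Sum>M<d * k. f M)"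
proof -
  have "(\<Sum>m'<k. f (k * m + m')) = sum f {m * k..<m * k + k}" for m
    using sum.shift_bounds_nat_ivl[of f 0 "m * k" k]
    by (simp add: atLeast0LessThan add_ac mult.commute)
  then show ?thesis
    by (simp add: sum.nat_group)
qed

text \<open>Each summand is the \<open>M\<close>-th power of \<open>z = cnj (r J) * r K\<close>, an
  \<open>n\<close>-th root of unity. The sum is therefore geometric and vanishes unless
  \<open>z = 1\<close>.\<close>

lemma sum_character_orthogonality:
  fixes n J K :: nat
  assumes "J < n" "K < n"
  shows "(\<Sum>M<n. cnj (exp (\<i> * of_real (2 * pi / n * J * M))) * exp (\<i> * of_real (2 * pi / n * K * M)))
    = (if J = K then of_nat n else 0)"
proof -
  define r where "r J = exp (2 * of_real pi * \<i> * of_nat J / of_nat n)" for J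
  have pow: "exp (\<i> * of_real (2 * pi / n * J * M)) = r J ^ M" for J M
    by (simp add: r_def exp_of_nat_mult[symmetric] mult_ac)
  have rn: "r J ^ n = 1" for J
    using assms complex_root_unity[of n J] by (simp add: r_def)
  have nm: "cmod (r J) = 1" for J
    by (simp add: r_def norm_exp_eq_Re)
  define z where "z = cnj (r J) * r K"
  have "cnj (r J ^ M) * r K ^ M = z ^ M" for M
    by (simp add: z_def power_mult_distrib)
  then have lhs: "(\<Sum>M<n. cnj (exp (\<i> * of_real (2 * pi / n * J * M))) * exp (\<i> * of_real (2 * pi / n * K * M)))
      = (\<Sum>M<n. z ^ M)"
    by (simp only: pow)
  \<comment> \<open>\<open>cnj (r J)\<close> is the inverse of \<open>r J\<close>, so
    \<open>z\<close> is the quotient of \<open>r K\<close> by \<open>r J\<close> and equals 1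
    exactly when these roots coincide. For indices below \<open>n\<close> that forces
    \<open>J = K\<close>.\<close>
  have unit: "r J * cnj (r J) = 1"
    using nm[of J] complex_norm_square[of "r J"] by simp
  have "r J * z = r K"
    using unit by (simp add: z_def mult.assoc[symmetric])
  then have "z = 1 \<longleftrightarrow> r J = r K"
    using unit by (metis mult.comm_neutral z_def mult.commute)
  also have "\<dots> \<longleftrightarrow> J = K"
    using complex_root_unity_eq[of n J K] assms by (auto simp: r_def cong_def)
  finally have z1: "z = 1 \<longleftrightarrow> J = K" .
  have "z ^ n = 1"
    using rn[of K] rn[of J] by (simp add: z_def power_mult_distrib flip: complex_cnj_power)
  then show ?thesis
    unfolding lhs using z1 geometric_sum[of z n] by auto
qed

theorem mainTheorem4:
  fixes d :: nat
    and e1 :: "nat \<Rightarrow> complex ^ 'a::finite"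
    and e2 :: "nat \<Rightarrow> complex ^ 'b::finite"
    and e3 :: "nat \<Rightarrow> complex ^ 'c::finite"
    and e4 :: "nat \<Rightarrow> complex ^ 'd::finite"
    and lam \<eta> :: "nat \<Rightarrow> real"
    and \<theta> :: "nat \<Rightarrow> nat \<Rightarrow> real"
    and P :: "nat \<Rightarrow> nat \<Rightarrow> complex ^ ('b \<times> 'c)"
    and \<Psi> :: "complex ^ (('a \<times> 'b) \<times> ('c \<times> 'd))"
    and Ua :: "nat \<Rightarrow> complex ^ 'a ^ 'a"
    and Ub :: "nat \<Rightarrow> nat \<Rightarrow> complex ^ 'd ^ 'd"
  assumes d: "d \<ge> 2"
    and dims: "CARD('a) = d" "CARD('b) = d" "CARD('c) = d" "CARD('d) = d"
    and bases: "orthonormal_on {..<d} e1" "orthonormal_on {..<d} e2"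
               "orthonormal_on {..<d} e3" "orthonormal_on {..<d} e4"
    and lam: "\<And>k. k < d \<Longrightarrow> lam k \<ge> 0" "(\<Sum>k<d. lam k) = 1"
    and eta: "\<And>k. k < d \<Longrightarrow> \<eta> k \<ge> 0" "(\<Sum>k<d. \<eta> k) = 1"
    and P: "P = P_state d \<theta> e2 e3"
    and Psi: "\<Psi> = tensor (schmidt_state d lam e1 e2) (schmidt_state d \<eta> e3 e4)"
    and Ua: "\<And>j' m. j' < d \<Longrightarrow> m < d \<Longrightarrow>
        Ua j' *v e1 m = exp (\<i> * complex_of_real (2 * pi / real d * real j' * real m)) *s e1 m"
    and Ub: "\<And>j j' m'. j < d \<Longrightarrow> j' < d \<Longrightarrow> m' < d \<Longrightarrow>
        Ub j j' *v e4 m' =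
          exp (\<i> * complex_of_real (2 * pi / real d ^ 2 * real (d * j + j') * real m')) *s e4 m'"
  shows "orthonormal_on ({..<d} \<times> {..<d}) (\<lambda>(j, j'). P j j') \<and>
    projective_measurement ({..<d} \<times> {..<d}) (\<lambda>(j, j'). ket_bra (P j j')) \<and>
    (\<forall>j<d. \<forall>j'<d.
       unitary_matrix (Ua j') \<and> unitary_matrix (Ub j j') \<and>
       extend_23 (ket_bra (P j j')) *v \<Psi> \<noteq> 0 \<and>
       sgn (extend_23 (ket_bra (P j j')) *v \<Psi>)
         = tensor_14_23 (sgn (partial_inner_23 (P j j') \<Psi>)) (P j j') \<and>
       same_state
         (tensor_matrix (Ua j') (Ub j j') *v sgn (partial_inner_23 (P j j') \<Psi>))
         (F_state d \<theta> lam \<eta> e1 e4))"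
proof -

  \<comment> \<open>Orthonormality and completeness of the measurement vectors\<close>
  define D where "D = {..<d} \<times> {..<d}"
  have finD: "finite D" and cardD: "card D = CARD('b \<times> 'c)"
    by (simp_all add: D_def dims)
  define T where "T = (\<lambda>q. tensor (e2 (fst q)) (e3 (snd q)))"
  have onT: "orthonormal_on D T"
    using orthonormal_on_tensor[OF bases(2,3)] by (simp add: T_def D_def)
  define G where "G = (\<lambda>q. tensor (e1 (fst q)) (e4 (snd q)))"
  have onG: "orthonormal_on D G"
    using orthonormal_on_tensor[OF bases(1,4)] by (simp add: G_def D_def)
  define ph where "ph = (\<lambda>j j' q. exp (\<i> * complex_of_real
      (2 * pi / real d ^ 2 * real (d * j + j') * real (d * fst q + snd q) + \<theta> (fst q) (snd q))))"
  have P_eq: "P j j' = (\<Sum>q\<in>D. (of_real (1 / real d) * ph j j' q) *s T q)" for j j'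
    by (simp add: P P_state_def vec_eq_iff sum_distrib_left sum.cartesian_product D_def T_def
        ph_def case_prod_beta mult_ac)
  have P_inner: "cinner (P j j') (P k k') = (if (j, j') = (k, k') then 1 else 0)"
    if "j < d" "j' < d" "k < d" "k' < d" for j j' k k'
  proof -
    \<comment> \<open>\<open>h\<close> is the bare Fourier character: the phase
      \<open>\<theta>\<close> depends on the basis pair but not on the outcome, so it cancels in
      every overlap.\<close>
    define h where "h J M = exp (\<i> * of_real (2 * pi / real (d * d) * real J * real M))" for J M
    have ph: "ph j j' q = h (d * j + j') (d * fst q + snd q) * exp (\<i> * of_real (\<theta> (fst q) (snd q)))"
      for j j' q
      by (simp add: ph_def h_def exp_add[symmetric] power2_eq_square distrib_left)
    \<comment> \<open>Outcomes are read as two-digit numbers in base \<open>d\<close>. This bound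
      and \<open>inj\<close> below let the Fourier orthogonality of order \<open>d * d\<close>
      apply.\<close>
    have lt: "d * j + j' < d * d" if "j < d" "j' < d" for j j'
    proof -
      have "d * j + j' < d * (j + 1)" using that by simp
      also have "\<dots> \<le> d * d" using that by (intro mult_le_mono2) simp
      finally show ?thesis .
    qed
    have inj: "d * j + j' = d * k + k' \<longleftrightarrow> (j, j') = (k, k')"
    proof
      assume eq: "d * j + j' = d * k + k'"
      have "(d * j + j') div d = j" "(d * j + j') mod d = j'" "(d * k + k') div d = k"
        "(d * k + k') mod d = k'"
        using that by auto
      with eq show "(j, j') = (k, k')" by simp
    qed simp
    have "cnj (exp (\<i> * of_real x)) * exp (\<i> * of_real x) = 1" for x
      by (simp add: exp_cnj exp_add[symmetric])
    then have overlap: "cnj (ph j j' q) * ph k k' q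
        = cnj (h (d * j + j') (d * fst q + snd q)) * h (d * k + k') (d * fst q + snd q)" for q
      by (simp add: ph mult_ac)
    have "cinner (P j j') (P k k') = (\<Sum>q\<in>D. cnj (of_real (1 / real d) * ph j j' q) * (of_real (1 / real d) * ph k k' q))"
      unfolding P_eq by (rule cinner_orthonormal_expansion[OF onT finD])
    also have "\<dots> = (\<Sum>q\<in>D. of_real (1 / real (d * d)) * (cnj (ph j j' q) * ph k k' q))"
      by (simp add: mult_ac)
    also have "\<dots> = of_real (1 / real (d * d)) * (\<Sum>q\<in>D. cnj (ph j j' q) * ph k k' q)"
      by (rule sum_distrib_left[symmetric])
    also have "(\<Sum>q\<in>D. cnj (ph j j' q) * ph k k' q)
        = (\<Sum>m<d. \<Sum>m'<d. cnj (h (d * j + j') (d * m + m')) * h (d * k + k') (d * m + m'))"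
      by (simp add: overlap D_def sum.cartesian_product case_prod_beta)
    \<comment> \<open>The basis pair likewise becomes a single index that runs once through all
      numbers below \<open>d * d\<close>.\<close>
    also have "\<dots> = (\<Sum>M<d * d. cnj (h (d * j + j') M) * h (d * k + k') M)"
      by (rule sum_nat_lex)
    also have "\<dots> = (if (j, j') = (k, k') then of_nat (d * d) else 0)"
      unfolding h_def using sum_character_orthogonality[OF lt lt] that inj by simp
    finally show ?thesis
      using d by simp
  qed
  have onP: "orthonormal_on D (\<lambda>(j, j'). P j j')"
    using P_inner by (auto simp: orthonormal_on_def D_def)
  \<comment> \<open>There are as many vectors as the dimension of 23, so orthonormality already
    gives a complete measurement.\<close>
  have proj: "projective_measurement D (\<lambda>(j, j'). ket_bra (P j j'))"
    using projective_measurement_ket_bra[OF onP finD cardD] by (simp add: case_prod_beta')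

  \<comment> \<open>The state of systems 1 and 4 after the measurement\<close>
  define am where "am = (\<lambda>q. complex_of_real (sqrt (lam (fst q))) * of_real (sqrt (\<eta> (snd q))))"
  define R where "R = (\<lambda>j j'. partial_inner_23 (P j j') \<Psi>)"
  have R_eq: "R j j' = (\<Sum>q\<in>D. (cnj (of_real (1 / real d) * ph j j' q) * am q) *s G q)" for j j'
    unfolding R_def P_eq Psi schmidt_state_def D_def T_def G_def am_def
    by (rule partial_inner_23_schmidt) (simp_all add: bases)
  have am_sq: "(\<Sum>q\<in>D. cnj (am q) * am q) = 1"
  proof -
    have "(\<Sum>q\<in>D. cnj (am q) * am q) = (\<Sum>q\<in>D. of_real (lam (fst q) * \<eta> (snd q)))"
      using lam(1) eta(1) 
      by (intro sum.cong refl)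
        (auto simp: am_def D_def mult_ac simp flip: of_real_mult mult.assoc[of "sqrt _"])
    also have "\<dots> = of_real ((\<Sum>m<d. lam m) * (\<Sum>m'<d. \<eta> m'))"
      by (simp add: D_def sum_product sum.cartesian_product case_prod_beta)
    finally show ?thesis by (simp add: lam eta)
  qed
  have ph_unit: "ph j j' q * cnj (ph j j' q) = 1" for j j' q
    by (simp add: ph_def exp_cnj exp_add[symmetric])
  \<comment> \<open>The phases have modulus 1 and the amplitudes \<open>am\<close> are normalized,
    so only the prefactor of the measurement vector survives. Hence no outcome gives the zero
    vector, and normalizing means multiplying by \<open>d\<close>.\<close>
  have norm_R: "norm (R j j') = 1 / real d" for j j'
  proof -
    have "cinner (R j j') (R j j') = (\<Sum>q\<in>D. cnj (cnj (of_real (1 / real d) * ph j j' q) * am q)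
        * (cnj (of_real (1 / real d) * ph j j' q) * am q))"
      unfolding R_eq by (rule cinner_orthonormal_expansion[OF onG finD])
    also have "\<dots> = (\<Sum>q\<in>D. of_real ((1 / real d)\<^sup>2) * (ph j j' q * cnj (ph j j' q)) * (cnj (am q) * am q))"
      by (simp add: mult_ac power2_eq_square)
    also have "\<dots> = of_real ((1 / real d)\<^sup>2)"
      by (simp only: ph_unit mult_1_right am_sq flip: sum_distrib_left)
    finally have "(norm (R j j'))\<^sup>2 = (1 / real d)\<^sup>2"
      unfolding cinner_self of_real_eq_iff .
    then show ?thesis
      by (subst (asm) power2_eq_iff_nonneg) auto
  qed
  have sgn_R: "sgn (R j j') = (\<Sum>q\<in>D. (cnj (ph j j' q) * am q) *s G q)" for j j'
  proof -
    have "sgn (R j j') = of_nat d *s R j j'"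
      by (simp add: sgn_vec_def norm_R vec_eq_iff scaleR_conv_of_real[where 'a = complex])
    also have "\<dots> = (\<Sum>q\<in>D. (cnj (ph j j' q) * am q) *s G q)"
      using d by (simp add: R_eq vec_eq_iff sum_distrib_left)
    finally show ?thesis .
  qed

  \<comment> \<open>Local corrections and the final state\<close>
  have outcome: "unitary_matrix (Ua j') \<and> unitary_matrix (Ub j j') \<and>
       extend_23 (ket_bra (P j j')) *v \<Psi> \<noteq> 0 \<and>
       sgn (extend_23 (ket_bra (P j j')) *v \<Psi>) = tensor_14_23 (sgn (R j j')) (P j j') \<and>
       same_state (tensor_matrix (Ua j') (Ub j j') *v sgn (R j j')) (F_state d \<theta> lam \<eta> e1 e4)"
    if j: "j < d" and j': "j' < d" for j j'
  proof -
    define \<alpha> where "\<alpha> = (\<lambda>m. exp (\<i> * complex_of_real (2 * pi / real d * real j' * real m)))"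
    define \<beta> where "\<beta> = (\<lambda>m'. exp (\<i> * complex_of_real (2 * pi / real d ^ 2 * real (d * j + j') * real m')))"
    have uA: "unitary_matrix (Ua j')"
      by (rule unitary_matrix_diagonal[OF bases(1), where c = \<alpha>])
        (simp_all add: dims Ua j' \<alpha>_def)
    have uB: "unitary_matrix (Ub j j')"
      by (rule unitary_matrix_diagonal[OF bases(4), where c = \<beta>])
        (simp_all add: dims Ub j j' \<beta>_def)
    have norm_P: "norm (P j j') = 1"
    proof -
      have "complex_of_real ((norm (P j j'))\<^sup>2) = of_real 1"
        using P_inner[OF j j' j j'] by (simp add: cinner_self)
      then show ?thesis
        unfolding of_real_eq_iff using norm_ge_zero[of "P j j'"]
        by (auto simp: power2_eq_1_iff simp del: norm_ge_zero)
    qed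
    have post: "extend_23 (ket_bra (P j j')) *v \<Psi> = tensor_14_23 (R j j') (P j j')"
      by (simp add: extend_23_ket_bra_mult R_def)
    have "norm (tensor_14_23 (R j j') (P j j')) \<noteq> 0"
      using d by (simp add: norm_tensor_14_23 norm_P norm_R)
    then have nz: "tensor_14_23 (R j j') (P j j') \<noteq> 0"
      by auto
    have phase: "\<alpha> m * \<beta> m' * cnj (ph j j' (m, m')) = exp (- \<i> * of_real (\<theta> m m'))" for m m'
    proof -
      have combine: "exp (\<i> * complex_of_real x) * exp (\<i> * of_real y) * cnj (exp (\<i> * of_real z))
          = exp (\<i> * of_real (x + y - z))" for x y z
        by (simp add: exp_cnj exp_add[symmetric] algebra_simps)
      \<comment> \<open>The terms containing \<open>m'\<close> cancel against Bob's phase and the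
        term in \<open>j' * m\<close> against Alice's. Besides \<open>- \<theta> m m'\<close> there
        remain \<open>j * m\<close> full turns, which the periodicity of \<open>exp\<close> removes
        below.\<close>
      have "2 * pi / real d * real j' * real m + 2 * pi / real d ^ 2 * real (d * j + j') * real m'
          - (2 * pi / real d ^ 2 * real (d * j + j') * real (d * m + m') + \<theta> m m')
          = - \<theta> m m' - 2 * pi * real (j * m)"
        using d by (simp add: field_simps power2_eq_square)
      then have "\<alpha> m * \<beta> m' * cnj (ph j j' (m, m'))
          = exp (\<i> * of_real (- \<theta> m m' - 2 * pi * real (j * m)))"
        unfolding \<alpha>_def \<beta>_def ph_def combine fst_conv snd_conv by (simp only:)
      also have "\<dots> = exp (- \<i> * of_real (\<theta> m m') + of_int (- int (j * m)) * (2 * of_real pi * \<i>))"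
        by (simp add: algebra_simps)
      also have "\<dots> = exp (- \<i> * of_real (\<theta> m m'))"
        by (subst exp_eq) (auto intro: exI[of _ "- int (j * m)"])
      finally show ?thesis .
    qed
    have UG: "tensor_matrix (Ua j') (Ub j j') *v G q = (\<alpha> (fst q) * \<beta> (snd q)) *s G q"
      if "q \<in> D" for q
      using that j j'
      by (auto simp: G_def D_def tensor_matrix_mult_tensor Ua Ub \<alpha>_def \<beta>_def tensor_smult)
    have "tensor_matrix (Ua j') (Ub j j') *v sgn (R j j')
        = (\<Sum>q\<in>D. (cnj (ph j j' q) * am q) *s ((\<alpha> (fst q) * \<beta> (snd q)) *s G q))"
      unfolding sgn_R matrix_vector_mult_sum_smult by (intro sum.cong refl) (simp add: UG)
    \<comment> \<open>Splitting \<open>q\<close> into its components brings the coefficient into the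
      form that \<open>phase\<close> rewrites.\<close>
    also have "\<dots> = (\<Sum>q\<in>D. (\<alpha> (fst q) * \<beta> (snd q) * cnj (ph j j' (fst q, snd q)) * am q) *s G q)"
      by (simp add: vector_smult_assoc mult_ac)
    also have "\<dots> = F_state d \<theta> lam \<eta> e1 e4"
      unfolding phase
      by (simp add: F_state_def D_def G_def am_def sum.cartesian_product case_prod_beta
          real_sqrt_mult mult_ac)
    \<comment> \<open>The corrected vector equals \<open>F_state\<close> exactly, so the witness for
      the global phase is 1.\<close>
    finally have "same_state (tensor_matrix (Ua j') (Ub j j') *v sgn (R j j')) (F_state d \<theta> lam \<eta> e1 e4)"
      by (auto simp: same_state_def intro!: exI[of _ 1])
    then show ?thesis
      using uA uB nz by (simp add: post sgn_tensor_14_23 norm_P)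
  qed
  show ?thesis
    using onP proj outcome by (simp add: D_def R_def)
qed

end
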